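(* Let $d\geq1$ and let $x_1,\dots,x_{d+1}$ be variables, not necessarily distinct (i.e. they form a multiset $X$), and let $\{x_{i_1},\dots,x_{i_l}\}$ be the set of distinct variables among them. Let $g(t)$ and $f_j(t)$, $j=1,\dots,d$, be functions such that for all nonnegative integers $k_1,\dots,k_d$ the function $\phi_{k_1,\dots,k_d}(x_{i_1},\dots,x_{i_l})=g(x_{d+1})\prod_{j=1}^d f_j^{k_j}(x_j)$ is defined on an $l$-dimensional domain $D$. Let $r$ be a nonnegative integer and define $$f(k_1,\dots,k_d)=\frac{(k_1+\cdots+k_d+r)!}{(k_1+\cdots+k_d)!}\int_D g(x_{d+1})\prod_{j=1}^d f_j^{k_j}(x_j)\,dx_{i_1}\cdots dx_{i_l}.$$ Then for any sequences $\{a^{(j)}_n\}_{n\geq0}$, $j=1,\dots,d$, with ordinary generating functions $A_j(x)=\sum_{n\geq0}a^{(j)}_nx^n$, $$\sum_{n\geq0}\sum_{k_1+\cdots+k_d=n}f(k_1,\dots,k_d)\,x^n\prod_{j=1}^d a^{(j)}_{k_j}=\frac{d^r}{dx^r}\left[x^r\int_D g(x_{d+1})\prod_{j=1}^dA_j(xf_j(x_j))\,dx_{i_1}\cdots dx_{i_l}\right].$$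
   Context: The sum over $k_1+\cdots+k_d=n$ runs over $d$-tuples of nonnegative integers. The identity is between power series in $x$: the integral on the right is understood as the power series in $x$ obtained by integrating term by term, all relevant integrals being assumed to exist. *)

theory Defs
  imports "HOL-Analysis.Analysis" "HOL-Computational_Algebra.Formal_Power_Series"
begin

text \<open>
  The distinct variables are indexed by a finite type \<open>'l\<close>, so a point is a vector
  \<open>p :: real ^ 'l\<close>; the map \<open>s :: nat \<Rightarrow> 'l\<close> says which distinct variable the entry \<open>x\<^sub>j\<close> of the
  multiset is, i.e. \<open>x\<^sub>j = p $ s j\<close> for \<open>1 \<le> j \<le> d + 1\<close>.
  Values and coefficients lie in a \<open>real_normed_field\<close>, which covers \<open>real\<close> and \<open>complex\<close>.
  All integrals are gauge (Henstock--Kurzweil) integrals over \<open>D\<close>, which for real- and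
  complex-valued functions extend the Lebesgue integral.
\<close>

definition phi ::
  "nat \<Rightarrow> (nat \<Rightarrow> 'l::finite) \<Rightarrow> (real \<Rightarrow> 'a::real_normed_field) \<Rightarrow> (nat \<Rightarrow> real \<Rightarrow> 'a)
    \<Rightarrow> (nat \<Rightarrow> nat) \<Rightarrow> real ^ 'l \<Rightarrow> 'a" where
  "phi d s g f k p = g (p $ s (d + 1)) * (\<Prod>j = 1..d. f j (p $ s j) ^ k j)"

definition weight ::
  "nat \<Rightarrow> nat \<Rightarrow> (nat \<Rightarrow> 'l::finite) \<Rightarrow> (real ^ 'l) set \<Rightarrow> (real \<Rightarrow> 'a::real_normed_field)
    \<Rightarrow> (nat \<Rightarrow> real \<Rightarrow> 'a) \<Rightarrow> (nat \<Rightarrow> nat) \<Rightarrow> 'a" where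
  "weight r d s D g f k =
     fact ((\<Sum>j = 1..d. k j) + r) / fact (\<Sum>j = 1..d. k j) * integral D (phi d s g f k)"

definition weak_compositions :: "nat \<Rightarrow> nat \<Rightarrow> (nat \<Rightarrow> nat) set" where
  "weak_compositions d n = {k \<in> {1..d} \<rightarrow>\<^sub>E UNIV. (\<Sum>j = 1..d. k j) = n}"

definition fps_scale_arg :: "'a::comm_ring_1 fps \<Rightarrow> 'a \<Rightarrow> 'a fps" where
  "fps_scale_arg A c = fps_compose A (fps_const c * fps_X)"

text \<open>The integral of a family of power series, taken term by term.\<close>

definition fps_termwise_integral :: "(real ^ 'l::finite) set \<Rightarrow> (real ^ 'l \<Rightarrow> 'a::real_normed_field fps) \<Rightarrow> 'a fps" where
  "fps_termwise_integral D F = Abs_fps (\<lambda>n. integral D (\<lambda>p. fps_nth (F p) n))"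

end

theory Submission
  imports Defs
begin

text \<open>
  Both sides are compared coefficientwise. The coefficient of \<open>x\<^sup>n\<close> in the product of the
  series \<open>A\<^sub>j(x f\<^sub>j(x\<^sub>j))\<close> is a finite sum over the weak compositions of \<open>n\<close>, so it may be
  interchanged with the integral; the operator \<open>d\<^sup>r/dx\<^sup>r (x\<^sup>r \<cdot>)\<close> multiplies that coefficient by
  \<open>(n + r)! / n!\<close>.
\<close>

lemma finite_PiE_sum_eq:
  assumes "finite J"
  shows "finite {k \<in> J \<rightarrow>\<^sub>E UNIV. sum k J = (n::nat)}"
proof (rule finite_subset)
  show "{k \<in> J \<rightarrow>\<^sub>E UNIV. sum k J = n} \<subseteq> J \<rightarrow>\<^sub>E {..n}"
    using assms by (auto simp: PiE_iff extensional_def intro: member_le_sum)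
  show "finite (J \<rightarrow>\<^sub>E {..n})"
    using assms by (intro finite_PiE) auto
qed

text \<open>Induction on \<open>J\<close>: the Cauchy product splits off the exponent
  \<open>m\<close> of the new factor and leaves total \<open>n - m\<close> for the rest.
  Extensionality of \<open>k\<close> outside \<open>J\<close> makes each tuple of exponents count
  once.\<close>

lemma fps_prod_nth:
  fixes F :: "'i \<Rightarrow> 'a::comm_ring_1 fps"
  assumes "finite J"
  shows "fps_nth (\<Prod>j\<in>J. F j) n =
    (\<Sum>k | k \<in> J \<rightarrow>\<^sub>E UNIV \<and> sum k J = n. \<Prod>j\<in>J. fps_nth (F j) (k j))"
  using assms
proof (induction J arbitrary: n rule: finite_induct)
  case empty
  show ?case
    by (cases "n = 0") (simp_all add: Collect_conv_if)
next
  case (insert x J)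
  let ?W = "\<lambda>I m. {k \<in> I \<rightarrow>\<^sub>E UNIV. sum k I = (m::nat)}"
  \<comment> \<open>Since \<open>x\<close> is not in \<open>J\<close>, changing \<open>k\<close> at
    \<open>x\<close> is invisible to sums and products over \<open>J\<close>.\<close>
  have sum_upd: "sum (k(x := m)) J = sum k J"
    and prod_upd: "(\<Prod>j\<in>J. fps_nth (F j) ((k(x := m)) j)) = (\<Prod>j\<in>J. fps_nth (F j) (k j))"
    for k and m :: nat
    using insert.hyps by (auto intro!: sum.cong prod.cong)
  have "fps_nth (\<Prod>j\<in>insert x J. F j) n =
      (\<Sum>m\<le>n. \<Sum>k\<in>?W J (n - m). fps_nth (F x) m * (\<Prod>j\<in>J. fps_nth (F j) (k j)))"
    using insert by (simp add: fps_mult_nth sum_distrib_left atLeast0AtMost)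
  also have "\<dots> = (\<Sum>(m, k)\<in>(SIGMA m:{..n}. ?W J (n - m)).
      fps_nth (F x) m * (\<Prod>j\<in>J. fps_nth (F j) (k j)))"
    using insert.hyps by (intro sum.Sigma ballI finite_PiE_sum_eq) auto
  also have "\<dots> = (\<Sum>k\<in>?W (insert x J) n. \<Prod>j\<in>insert x J. fps_nth (F j) (k j))"
  \<comment> \<open>A tuple on \<open>insert x J\<close> is its value at \<open>x\<close> together
    with its restriction to \<open>J\<close>; resetting to \<open>undefined\<close> at
    \<open>x\<close> makes that restriction extensional again.\<close>
  proof (rule sum.reindex_bij_witness[where i = "\<lambda>k. (k x, k(x := undefined))"
        and j = "\<lambda>(m, k). k(x := m)"])
    fix p assume "p \<in> (SIGMA m:{..n}. ?W J (n - m))"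
    then obtain m k where p: "p = (m, k)" "m \<le> n" "k \<in> J \<rightarrow>\<^sub>E UNIV" "sum k J = n - m"
      by auto
    then have "k x = undefined"
      using insert.hyps by (auto simp: PiE_iff extensional_def)
    then show "(\<lambda>k. (k x, k(x := undefined))) ((\<lambda>(m, k). k(x := m)) p) = p"
      using p by (auto simp: fun_eq_iff)
    show "(\<lambda>(m, k). k(x := m)) p \<in> ?W (insert x J) n"
      using p insert.hyps sum_upd[of k m] by (auto simp: PiE_iff extensional_def)
    show "(\<Prod>j\<in>insert x J. fps_nth (F j) ((\<lambda>(m, k). k(x := m)) p j)) =
        (\<lambda>(m, k). fps_nth (F x) m * (\<Prod>j\<in>J. fps_nth (F j) (k j))) p"
      using p insert.hyps prod_upd[of k m] by simp
  next
    fix k assume k: "k \<in> ?W (insert x J) n"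
    then show "(\<lambda>k. (k x, k(x := undefined))) k \<in> (SIGMA m:{..n}. ?W J (n - m))"
      using insert.hyps sum_upd[of k undefined] by (auto simp: PiE_iff extensional_def)
    show "(\<lambda>(m, k). k(x := m)) ((\<lambda>k. (k x, k(x := undefined))) k) = k"
      by simp
  qed
  finally show ?case .
qed

lemma fps_scale_arg_nth: "fps_nth (fps_scale_arg A c) n = c ^ n * fps_nth A n"
  by (simp add: fps_scale_arg_def fps_compose_linear)

text \<open>Each derivative shifts the index by one and contributes one factor of
  \<open>(n + 1) \<cdots> (n + r)\<close>.\<close>

lemma fps_deriv_funpow_nth:
  fixes F :: "'a::field_char_0 fps"
  shows "fps_nth ((fps_deriv ^^ r) F) n = fact (n + r) / fact n * fps_nth F (n + r)"
proof (induction r arbitrary: n)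
  case (Suc r)
  have "fps_nth ((fps_deriv ^^ Suc r) F) n =
      of_nat (Suc n) * (fact (Suc n + r) / fact (Suc n) * fps_nth F (Suc n + r))"
    by (simp only: funpow.simps comp_apply fps_deriv_nth Suc_eq_plus1[symmetric] Suc.IH)
  also have "\<dots> = fact (n + Suc r) / fact n * fps_nth F (n + Suc r)"
    \<comment> \<open>Only the denominator \<open>fact (Suc n)\<close> is expanded, so that its
      factor \<open>of_nat (Suc n)\<close> cancels.\<close>
    unfolding fact_Suc[of n] add_Suc add_Suc_right
    by (simp only: of_nat_mult mult.assoc[symmetric] times_divide_eq_right)
      (simp del: of_nat_Suc fact_Suc)
  finally show ?case .
qed simp

lemma finite_weak_compositions: "finite (weak_compositions d n)"
  unfolding weak_compositions_def by (simp add: finite_PiE_sum_eq)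

theorem theorem3:
  fixes d r :: nat
    and s :: "nat \<Rightarrow> 'l::finite"
    and D :: "(real ^ 'l) set"
    and g :: "real \<Rightarrow> 'a::real_normed_field"
    and f :: "nat \<Rightarrow> real \<Rightarrow> 'a"
    and a :: "nat \<Rightarrow> nat \<Rightarrow> 'a"
  assumes "d \<ge> 1"
    and "s ` {1..d + 1} = UNIV"
    and "\<And>k. phi d s g f k integrable_on D"
  shows "Abs_fps (\<lambda>n. \<Sum>k\<in>weak_compositions d n. weight r d s D g f k * (\<Prod>j = 1..d. a j (k j)))
       = (fps_deriv ^^ r) (fps_X ^ r *
           fps_termwise_integral D (\<lambda>p. fps_const (g (p $ s (d + 1))) *
             (\<Prod>j = 1..d. fps_scale_arg (Abs_fps (a j)) (f j (p $ s j)))))"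
proof (rule fps_ext)
  fix n
  let ?F = "\<lambda>p. fps_const (g (p $ s (d + 1))) *
    (\<Prod>j = 1..d. fps_scale_arg (Abs_fps (a j)) (f j (p $ s j)))"
  let ?c = "\<lambda>k. \<Prod>j = 1..d. a j (k j)"
  let ?W = "weak_compositions d n"
  let ?q = "fact (n + r) / fact n :: 'a"
  \<comment> \<open>The powers of \<open>f j\<close> produced by scaling combine with
    \<open>g\<close> into \<open>phi\<close>; what remains, \<open>?c k\<close>, does not depend on
    \<open>p\<close>.\<close>
  have coeff: "fps_nth (?F p) n = (\<Sum>k\<in>?W. phi d s g f k p * ?c k)" for p
    by (simp add: fps_prod_nth fps_scale_arg_nth weak_compositions_def phi_def prod.distrib
        sum_distrib_left mult.assoc)
  have "fps_nth ((fps_deriv ^^ r) (fps_X ^ r * fps_termwise_integral D ?F)) n =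
      ?q * fps_nth (fps_termwise_integral D ?F) n"
    \<comment> \<open>The shift by \<open>fps_X ^ r\<close> undoes the index shift of the
      derivatives; as \<open>n + r\<close> is never below \<open>r\<close>, the zero case does not
      arise.\<close>
    by (simp only: fps_deriv_funpow_nth fps_X_power_mult_nth) simp
  also have "\<dots> = ?q * integral D (\<lambda>p. \<Sum>k\<in>?W. phi d s g f k p * ?c k)"
    by (simp only: fps_termwise_integral_def fps_nth_Abs_fps coeff)
  also have "\<dots> = ?q * (\<Sum>k\<in>?W. integral D (phi d s g f k) * ?c k)"
    using assms(3)
    by (intro arg_cong2[where f = times] refl integral_unique has_integral_sum
        finite_weak_compositions has_integral_mult_left integrable_integral)
  also have "\<dots> = (\<Sum>k\<in>?W. weight r d s D g f k * ?c k)"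
    unfolding sum_distrib_left
    \<comment> \<open>On \<open>?W\<close> the entries of \<open>k\<close> sum to \<open>n\<close>,
      so the factorial quotient in \<open>weight\<close> is the constant \<open>?q\<close>.\<close>
    by (intro sum.cong) (simp_all add: weight_def weak_compositions_def mult.assoc)
  finally show "fps_nth (Abs_fps (\<lambda>n. \<Sum>k\<in>weak_compositions d n. weight r d s D g f k * ?c k)) n =
      fps_nth ((fps_deriv ^^ r) (fps_X ^ r * fps_termwise_integral D ?F)) n"
    by (simp only: fps_nth_Abs_fps)
qed

end
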